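(* Let $\Gamma=(V,E)$ be a simple graph, let $F(V)$ be the free left regular band on $V$, and let $B(\Gamma)$ be the free partially commutative left regular band associated with $\Gamma$. For $v,w\in F(V)$, the images of $v$ and $w$ in $B(\Gamma)$ are equal if and only if $\sigma(v)=\sigma(w)$ and $\mathcal O(v)=\mathcal O(w)$.
   Context: A left regular band is a semigroup satisfying $x^2=x$ and $xyx=xy$ for all $x,y$. The free left regular band $F(V)$ is the set of words over the alphabet $V$ with no repeated letters (including the empty word $1$), with multiplication given by concatenation followed by deletion of every letter that already occurred earlier (reading left to right); e.g. $523\cdot 13245=52314$. For $w\in F(V)$, $\sigma(w)\subseteq V$ is the set of letters occurring in $w$. $B(\Gamma)$ is the left regular band (monoid) with presentation $\langle V \mid xy=yx \text{ for all edges } \{x,y\}\in E\rangle$, i.e. the quotient of $F(V)$ by the least congruence containing these relations. For $w\in F(V)$, $\mathcal O(w)$ is the acyclic orientation of the induced subgraph of the complement graph $\overline\Gamma$ on the vertex set $\sigma(w)$ given as follows: for distinct $x,y\in\sigma(w)$ with $\{x,y\}\notin E$, there is an edge $x\to y$ if $x$ occurs before $y$ in $w$. *)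

theory Defs
  imports "Graph_Theory.Pair_Digraph" "HOL-Algebra.Group"
begin

section \<open>Left regular bands, congruences and quotients\<close>

definition left_regular_band :: "('a, 'b) monoid_scheme \<Rightarrow> bool" where
  "left_regular_band M \<longleftrightarrow> monoid M \<and>
     (\<forall>x\<in>carrier M. x \<otimes>\<^bsub>M\<^esub> x = x) \<and>
     (\<forall>x\<in>carrier M. \<forall>y\<in>carrier M. x \<otimes>\<^bsub>M\<^esub> y \<otimes>\<^bsub>M\<^esub> x = x \<otimes>\<^bsub>M\<^esub> y)"

definition monoid_congruence :: "('a, 'b) monoid_scheme \<Rightarrow> 'a rel \<Rightarrow> bool" where
  "monoid_congruence M r \<longleftrightarrow> equiv (carrier M) r \<and>
     (\<forall>(a, a')\<in>r. \<forall>(b, b')\<in>r. (a \<otimes>\<^bsub>M\<^esub> b, a' \<otimes>\<^bsub>M\<^esub> b') \<in> r)"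

definition generated_congruence :: "('a, 'b) monoid_scheme \<Rightarrow> 'a rel \<Rightarrow> 'a rel" where
  "generated_congruence M R = \<Inter>{r. monoid_congruence M r \<and> R \<subseteq> r}"

definition quotient_monoid :: "('a, 'b) monoid_scheme \<Rightarrow> 'a rel \<Rightarrow> 'a set monoid" where
  "quotient_monoid M r =
     \<lparr>carrier = carrier M // r,
      monoid.mult = (\<lambda>X Y. \<Union>x\<in>X. \<Union>y\<in>Y. r `` {x \<otimes>\<^bsub>M\<^esub> y}),
      one = r `` {\<one>\<^bsub>M\<^esub>}\<rparr>"

lemma total_monoid_congruence:
  assumes "monoid M"
  shows "monoid_congruence M (carrier M \<times> carrier M)"
proof -
  have "equiv (carrier M) (carrier M \<times> carrier M)"
    by (auto simp: equiv_def refl_on_def sym_def trans_def)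
  then show ?thesis
    using assms by (auto simp: monoid_congruence_def monoid.m_closed)
qed

lemma monoid_congruence_generated:
  assumes "monoid M" and R: "R \<subseteq> carrier M \<times> carrier M"
  shows "monoid_congruence M (generated_congruence M R)"
proof -
  let ?S = "{r. monoid_congruence M r \<and> R \<subseteq> r}"
  have T: "carrier M \<times> carrier M \<in> ?S"
    using total_monoid_congruence[OF assms(1)] R by blast
  have eq: "equiv (carrier M) r" if "r \<in> ?S" for r
    using that by (simp add: monoid_congruence_def)
  have "equiv (carrier M) (\<Inter>?S)"
  proof (rule equivI)
    show "\<Inter>?S \<subseteq> carrier M \<times> carrier M" using T by (rule Inter_lower)
    show "refl_on (carrier M) (\<Inter>?S)"
    proof (rule refl_onI, rule InterI)
      fix x r assume "x \<in> carrier M" "r \<in> ?S"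
      then show "(x, x) \<in> r" using eq[of r] by (meson equiv_def refl_onD)
    qed
    show "sym (\<Inter>?S)"
    proof (rule symI, rule InterI)
      fix x y r assume "(x, y) \<in> \<Inter>?S" and r: "r \<in> ?S"
      then have "(x, y) \<in> r" by (rule InterD)
      then show "(y, x) \<in> r" using eq[OF r] by (meson equiv_def symD)
    qed
    show "trans (\<Inter>?S)"
    proof (rule transI, rule InterI)
      fix x y z r assume xy: "(x, y) \<in> \<Inter>?S" and yz: "(y, z) \<in> \<Inter>?S" and r: "r \<in> ?S"
      have "(x, y) \<in> r" using xy r by (rule InterD)
      moreover have "(y, z) \<in> r" using yz r by (rule InterD)
      ultimately show "(x, z) \<in> r" using eq[OF r] by (meson equiv_def transD)
    qed
  qed
  moreover have "(a \<otimes>\<^bsub>M\<^esub> b, a' \<otimes>\<^bsub>M\<^esub> b') \<in> \<Inter>?S"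
    if "(a, a') \<in> \<Inter>?S" "(b, b') \<in> \<Inter>?S" for a a' b b'
  proof (rule InterI)
    fix r assume r: "r \<in> ?S"
    have "(a, a') \<in> r" "(b, b') \<in> r"
      using that r by (auto intro: InterD)
    then show "(a \<otimes>\<^bsub>M\<^esub> b, a' \<otimes>\<^bsub>M\<^esub> b') \<in> r"
      using r by (auto simp: monoid_congruence_def)
  qed
  moreover define I where "I = \<Inter>?S"
  ultimately have "equiv (carrier M) I"
    and "\<And>a a' b b'. (a, a') \<in> I \<Longrightarrow> (b, b') \<in> I \<Longrightarrow> (a \<otimes>\<^bsub>M\<^esub> b, a' \<otimes>\<^bsub>M\<^esub> b') \<in> I"
    by blast+
  then have "monoid_congruence M I"
    unfolding monoid_congruence_def by blast
  then show ?thesis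
    by (simp add: I_def generated_congruence_def)
qed

lemma quotient_monoid_mult:
  assumes "monoid M" "monoid_congruence M r" "a \<in> carrier M" "b \<in> carrier M"
  shows "r `` {a} \<otimes>\<^bsub>quotient_monoid M r\<^esub> r `` {b} = r `` {a \<otimes>\<^bsub>M\<^esub> b}"
proof -
  have eq: "equiv (carrier M) r" using assms(2) by (simp add: monoid_congruence_def)
  have *: "r `` {x \<otimes>\<^bsub>M\<^esub> y} = r `` {a \<otimes>\<^bsub>M\<^esub> b}" if "(a, x) \<in> r" "(b, y) \<in> r" for x y
  proof -
    have "(a \<otimes>\<^bsub>M\<^esub> b, x \<otimes>\<^bsub>M\<^esub> y) \<in> r"
      using assms(2) that by (auto simp: monoid_congruence_def)
    then show ?thesis by (rule equiv_class_eq[OF eq, symmetric])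
  qed
  have ne: "a \<in> r `` {a}" "b \<in> r `` {b}"
    using equiv_class_self[OF eq] assms(3,4) by simp_all
  have "(\<Union>x\<in>r `` {a}. \<Union>y\<in>r `` {b}. r `` {x \<otimes>\<^bsub>M\<^esub> y}) =
      (\<Union>x\<in>r `` {a}. \<Union>y\<in>r `` {b}. r `` {a \<otimes>\<^bsub>M\<^esub> b})"
    by (intro SUP_cong refl *) simp_all
  also have "\<dots> = r `` {a \<otimes>\<^bsub>M\<^esub> b}"
    using ne by blast
  finally show ?thesis by (simp add: quotient_monoid_def)
qed

lemma left_regular_band_quotient:
  assumes "left_regular_band M" "monoid_congruence M r"
  shows "left_regular_band (quotient_monoid M r)"
proof -
  have M: "monoid M" using assms(1) by (simp add: left_regular_band_def)
  interpret monoid M by (fact M)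
  let ?Q = "quotient_monoid M r"
  have car: "carrier ?Q = (\<lambda>x. r `` {x}) ` carrier M"
    by (auto simp: quotient_monoid_def quotient_def)
  have one: "\<one>\<^bsub>?Q\<^esub> = r `` {\<one>\<^bsub>M\<^esub>}" by (simp add: quotient_monoid_def)
  note mul = quotient_monoid_mult[OF M assms(2)]
  have "monoid ?Q"
    by (rule monoidI) (auto simp: car one mul m_assoc)
  then show ?thesis
    using assms(1) unfolding left_regular_band_def by (auto simp: car mul)
qed

section \<open>The free left regular band\<close>

text \<open>Unlike \<^const>\<open>remdups\<close>, which keeps last occurrences,
  this keeps the first occurrence of each letter.\<close>

primrec keep_first :: "'a list \<Rightarrow> 'a list" where
  "keep_first [] = []"
| "keep_first (x # xs) = x # removeAll x (keep_first xs)"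

definition free_lrb :: "'a set \<Rightarrow> 'a list monoid" where
  "free_lrb V =
     \<lparr>carrier = {w. distinct w \<and> set w \<subseteq> V},
      monoid.mult = (\<lambda>u v. keep_first (u @ v)),
      one = []\<rparr>"

lemma "[5,2,3] \<otimes>\<^bsub>free_lrb {1..5}\<^esub> [1,3,2,4,5] = [5,2,3,1,4::nat]"
  by (simp add: free_lrb_def)

lemma set_keep_first [simp]: "set (keep_first xs) = set xs"
  by (induction xs) auto

lemma distinct_keep_first [simp]: "distinct (keep_first xs)"
  by (induction xs) (auto simp: distinct_removeAll)

lemma keep_first_id: "distinct xs \<Longrightarrow> keep_first xs = xs"
  by (induction xs) auto

lemma keep_first_append:
  "keep_first (xs @ ys) = keep_first xs @ filter (\<lambda>y. y \<notin> set xs) (keep_first ys)"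
proof (induction xs)
  case (Cons x xs)
  have "removeAll x (filter (\<lambda>y. y \<notin> set xs) zs) = filter (\<lambda>y. y \<notin> set (x # xs)) zs" for zs
    by (induction zs) auto
  then show ?case using Cons by simp
qed simp

lemma keep_first_append_left: "keep_first (keep_first xs @ ys) = keep_first (xs @ ys)"
  by (simp add: keep_first_append keep_first_id)

lemma keep_first_append_right: "keep_first (xs @ keep_first ys) = keep_first (xs @ ys)"
  by (simp add: keep_first_append keep_first_id)

lemma left_regular_band_free_lrb: "left_regular_band (free_lrb V)"
proof -
  have car: "w \<in> carrier (free_lrb V) \<longleftrightarrow> distinct w \<and> set w \<subseteq> V" for w
    by (simp add: free_lrb_def)
  have mul: "u \<otimes>\<^bsub>free_lrb V\<^esub> v = keep_first (u @ v)" for u v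
    by (simp add: free_lrb_def)
  have one: "\<one>\<^bsub>free_lrb V\<^esub> = []"
    by (simp add: free_lrb_def)
  have 1: "monoid (free_lrb V)"
    by (rule monoidI)
      (simp_all add: car mul one keep_first_id keep_first_append_left keep_first_append_right)
  have 2: "keep_first (u @ v) = u"
    if "distinct u" "set v \<subseteq> set u" for u v :: "'a list"
  proof -
    have "filter (\<lambda>y. y \<notin> set u) (keep_first v) = []"
      using that by (auto simp: filter_empty_conv)
    then show ?thesis using that by (simp add: keep_first_append keep_first_id)
  qed
  have 3: "u \<otimes>\<^bsub>free_lrb V\<^esub> u = u" if "u \<in> carrier (free_lrb V)" for u
    using that by (simp add: car mul 2)
  have 4: "u \<otimes>\<^bsub>free_lrb V\<^esub> v \<otimes>\<^bsub>free_lrb V\<^esub> u = u \<otimes>\<^bsub>free_lrb V\<^esub> v" for u v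
    by (simp add: mul 2)
  show ?thesis
    using 1 3 4 unfolding left_regular_band_def by blast
qed

section \<open>Free partially commutative left regular bands\<close>

definition simple_graph :: "'a set \<Rightarrow> 'a set set \<Rightarrow> bool" where
  "simple_graph V E \<longleftrightarrow> (\<forall>e\<in>E. e \<subseteq> V \<and> card e = 2)"

definition commutation_relations :: "'a set \<Rightarrow> 'a set set \<Rightarrow> 'a list rel" where
  "commutation_relations V E =
     {([x] \<otimes>\<^bsub>free_lrb V\<^esub> [y], [y] \<otimes>\<^bsub>free_lrb V\<^esub> [x]) | x y. {x, y} \<in> E}"

definition pc_congruence :: "'a set \<Rightarrow> 'a set set \<Rightarrow> 'a list rel" where
  "pc_congruence V E = generated_congruence (free_lrb V) (commutation_relations V E)"

definition pc_lrb :: "'a set \<Rightarrow> 'a set set \<Rightarrow> 'a list set monoid" where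
  "pc_lrb V E = quotient_monoid (free_lrb V) (pc_congruence V E)"

definition pc_image :: "'a set \<Rightarrow> 'a set set \<Rightarrow> 'a list \<Rightarrow> 'a list set" where
  "pc_image V E w = pc_congruence V E `` {w}"

lemma monoid_congruence_pc_congruence:
  assumes "simple_graph V E"
  shows "monoid_congruence (free_lrb V) (pc_congruence V E)"
  unfolding pc_congruence_def
proof (rule monoid_congruence_generated)
  show "monoid (free_lrb V)"
    using left_regular_band_free_lrb[of V] by (simp add: left_regular_band_def)
  show "commutation_relations V E \<subseteq> carrier (free_lrb V) \<times> carrier (free_lrb V)"
  proof
    fix p assume "p \<in> commutation_relations V E"
    then obtain x y where p: "p = (keep_first [x, y], keep_first [y, x])" and "{x, y} \<in> E"
      by (auto simp: commutation_relations_def free_lrb_def)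
    then have "x \<in> V" "y \<in> V" using assms by (auto simp: simple_graph_def)
    then have "set (keep_first [x, y]) \<subseteq> V" "set (keep_first [y, x]) \<subseteq> V"
      by (simp_all only: set_keep_first) simp_all
    then show "p \<in> carrier (free_lrb V) \<times> carrier (free_lrb V)"
      using distinct_keep_first[of "[x, y]"] distinct_keep_first[of "[y, x]"]
      by (simp only: p free_lrb_def mem_Times_iff fst_conv snd_conv monoid.simps partial_object.simps mem_Collect_eq)
  qed
qed

lemma left_regular_band_pc_lrb:
  "simple_graph V E \<Longrightarrow> left_regular_band (pc_lrb V E)"
  unfolding pc_lrb_def
  by (intro left_regular_band_quotient left_regular_band_free_lrb monoid_congruence_pc_congruence)

lemma pc_image_hom:
  assumes "simple_graph V E"
  shows "pc_image V E \<in> hom (free_lrb V) (pc_lrb V E)"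
proof (rule homI)
  have M: "monoid (free_lrb V)"
    using left_regular_band_free_lrb[of V] by (simp add: left_regular_band_def)
  fix v w assume "v \<in> carrier (free_lrb V)" "w \<in> carrier (free_lrb V)"
  then show "pc_image V E (v \<otimes>\<^bsub>free_lrb V\<^esub> w) = pc_image V E v \<otimes>\<^bsub>pc_lrb V E\<^esub> pc_image V E w"
    using quotient_monoid_mult[OF M monoid_congruence_pc_congruence[OF assms]]
    by (simp add: pc_image_def pc_lrb_def)
next
  fix w assume "w \<in> carrier (free_lrb V)"
  then show "pc_image V E w \<in> carrier (pc_lrb V E)"
    by (simp add: pc_image_def pc_lrb_def quotient_monoid_def quotientI)
qed

section \<open>The orientation of a word\<close>

definition complement_edges :: "'a set \<Rightarrow> 'a set set \<Rightarrow> 'a set set" where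
  "complement_edges V E = {{x, y} | x y. x \<in> V \<and> y \<in> V \<and> x \<noteq> y \<and> {x, y} \<notin> E}"

definition induced_edges :: "'a set set \<Rightarrow> 'a set \<Rightarrow> 'a set set" where
  "induced_edges E S = {e\<in>E. e \<subseteq> S}"

definition occurs_before :: "'a list \<Rightarrow> 'a \<Rightarrow> 'a \<Rightarrow> bool" where
  "occurs_before w x y \<longleftrightarrow> (\<exists>i j. i < j \<and> j < length w \<and> w ! i = x \<and> w ! j = y)"

definition orientation :: "'a set \<Rightarrow> 'a set set \<Rightarrow> 'a list \<Rightarrow> 'a pair_pre_digraph" where
  "orientation V E w =
     \<lparr>pverts = set w,
      parcs = {(x, y). {x, y} \<in> induced_edges (complement_edges V E) (set w)
                        \<and> occurs_before w x y}\<rparr>"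

lemma orientation_arc_iff:
  assumes "w \<in> carrier (free_lrb V)"
  shows "(x, y) \<in> parcs (orientation V E w) \<longleftrightarrow>
    x \<in> set w \<and> y \<in> set w \<and> x \<noteq> y \<and> {x, y} \<notin> E \<and> occurs_before w x y"
proof -
  have "set w \<subseteq> V" using assms by (simp add: free_lrb_def)
  then have "{x, y} \<in> induced_edges (complement_edges V E) (set w) \<longleftrightarrow>
      x \<in> set w \<and> y \<in> set w \<and> x \<noteq> y \<and> {x, y} \<notin> E"
    unfolding induced_edges_def complement_edges_def
    by (auto simp: doubleton_eq_iff insert_commute[of x y])
  then show ?thesis by (simp add: orientation_def)
qed

lemma orientation_orients:
  assumes "w \<in> carrier (free_lrb V)"
    and "{x, y} \<in> induced_edges (complement_edges V E) (set w)"
  shows "((x, y) \<in> parcs (orientation V E w)) \<noteq> ((y, x) \<in> parcs (orientation V E w))"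
proof -
  have d: "distinct w" using assms(1) by (simp add: free_lrb_def)
  have xy: "x \<noteq> y" "x \<in> set w" "y \<in> set w"
    using assms(2) by (auto simp: induced_edges_def complement_edges_def doubleton_eq_iff)
  obtain i j where ij: "i < length w" "w ! i = x" "j < length w" "w ! j = y"
    using xy by (metis in_set_conv_nth)
  then have "i \<noteq> j" using xy by auto
  then have "occurs_before w x y \<noteq> occurs_before w y x"
    unfolding occurs_before_def using ij d
    by (metis linorder_neqE_nat nth_eq_iff_index_eq order.strict_trans order_less_asym)
  then show ?thesis
    using assms(2) by (simp add: orientation_def insert_commute[of y x])
qed

lemma orientation_acyclic:
  assumes "w \<in> carrier (free_lrb V)"
  shows "acyclic (parcs (orientation V E w))"
proof -
  have d: "distinct w" using assms by (simp add: free_lrb_def)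
  define pos where "pos x = (THE i. i < length w \<and> w ! i = x)" for x
  have pos: "pos (w ! i) = i" if "i < length w" for i
    unfolding pos_def using that d by (auto simp: nth_eq_iff_index_eq)
  have "parcs (orientation V E w) \<subseteq> measure pos"
    by (auto simp: orientation_def occurs_before_def pos)
  then show ?thesis by (metis acyclic_subset wf_acyclic wf_measure)
qed

end

theory Submission
  imports Defs
begin

text \<open>Having the same letters and the same orientation is a congruence on the free left regular
  band that contains the commutation relations, which gives one direction. Conversely, if \<open>x # v\<close>
  and \<open>w\<close> have the same letters and the same orientation, then every letter preceding \<open>x\<close> in \<open>w\<close>
  is adjacent to \<open>x\<close>; hence \<open>x\<close> can be commuted to the front of \<open>w\<close>, and one continues with the
  remaining words by induction.\<close>

lemma occurs_before_Nil [simp]: "\<not> occurs_before [] x y"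
  by (simp add: occurs_before_def)

text \<open>Replaces the index definition by a recursion on the word: a pair either starts at the
  head or lies wholly in the tail. The facts on \<open>occurs_before\<close> that follow then need
  only list induction and no indices.\<close>

lemma occurs_before_Cons [simp]:
  "occurs_before (a # w) x y \<longleftrightarrow> x = a \<and> y \<in> set w \<or> occurs_before w x y"
proof
  assume "occurs_before (a # w) x y"
  then obtain i j where ij: "i < j" "j < length (a # w)" "(a # w) ! i = x" "(a # w) ! j = y"
    unfolding occurs_before_def by blast
  then obtain j' where j: "j = Suc j'" by (cases j) auto
  show "x = a \<and> y \<in> set w \<or> occurs_before w x y"
  proof (cases i)
    case 0
    then show ?thesis using ij j by auto
  next
    case (Suc i')
    then have "i' < j'" "j' < length w" "w ! i' = x" "w ! j' = y" using ij j by auto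
    then show ?thesis unfolding occurs_before_def by blast
  qed
next
  assume "x = a \<and> y \<in> set w \<or> occurs_before w x y"
  then show "occurs_before (a # w) x y"
  proof
    assume "x = a \<and> y \<in> set w"
    then obtain j where "j < length w" "w ! j = y" "x = a" by (auto simp: in_set_conv_nth)
    then show ?thesis
      unfolding occurs_before_def by (intro exI[of _ 0] exI[of _ "Suc j"]) simp
  next
    assume "occurs_before w x y"
    then obtain i j where "i < j" "j < length w" "w ! i = x" "w ! j = y"
      unfolding occurs_before_def by blast
    then show ?thesis
      unfolding occurs_before_def by (intro exI[of _ "Suc i"] exI[of _ "Suc j"]) simp
  qed
qed

lemma occurs_before_in_set: "occurs_before w x y \<Longrightarrow> x \<in> set w \<and> y \<in> set w"
  by (induction w) auto

lemma occurs_before_append [simp]: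
  "occurs_before (u @ w) x y \<longleftrightarrow>
    occurs_before u x y \<or> occurs_before w x y \<or> x \<in> set u \<and> y \<in> set w"
  by (induction u) auto

lemma occurs_before_filter [simp]:
  "occurs_before (filter P w) x y \<longleftrightarrow> P x \<and> P y \<and> occurs_before w x y"
  by (induction w) (auto dest: occurs_before_in_set)

lemma occurs_before_irrefl: "distinct w \<Longrightarrow> \<not> occurs_before w x x"
  by (induction w) auto

text \<open>Equality of the orientations, phrased without \<open>V\<close> and without requiring x
  \<noteq> y. On the carrier this changes nothing: the letters lie in \<open>V\<close>, and no
  letter precedes itself in a repetition-free word.\<close>

definition same_orientation :: "'a set set \<Rightarrow> 'a list \<Rightarrow> 'a list \<Rightarrow> bool" where
  "same_orientation E v w \<longleftrightarrow> set v = set w \<and>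
     (\<forall>x y. {x, y} \<notin> E \<longrightarrow> occurs_before v x y = occurs_before w x y)"

lemma same_orientation_iff:
  assumes "v \<in> carrier (free_lrb V)" "w \<in> carrier (free_lrb V)"
  shows "same_orientation E v w \<longleftrightarrow> set v = set w \<and> orientation V E v = orientation V E w"
proof -
  have arc: "(x, y) \<in> parcs (orientation V E u) \<longleftrightarrow> {x, y} \<notin> E \<and> occurs_before u x y"
    if "u \<in> carrier (free_lrb V)" for u x y
    using that occurs_before_irrefl[of u x]
    by (auto simp: orientation_arc_iff[OF that] free_lrb_def dest: occurs_before_in_set)
  have "orientation V E v = orientation V E w \<longleftrightarrow>
      set v = set w \<and> parcs (orientation V E v) = parcs (orientation V E w)"
    by (simp add: orientation_def)
  also have "parcs (orientation V E v) = parcs (orientation V E w) \<longleftrightarrow>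
      (\<forall>x y. {x, y} \<notin> E \<longrightarrow> occurs_before v x y = occurs_before w x y)"
    using arc[OF assms(1)] arc[OF assms(2)] by (auto simp: set_eq_iff)
  finally show ?thesis by (auto simp: same_orientation_def)
qed

lemma carrier_free_lrb: "w \<in> carrier (free_lrb V) \<longleftrightarrow> distinct w \<and> set w \<subseteq> V"
  by (simp add: free_lrb_def)

text \<open>With repetition-free factors, deletion only touches the second one. In this form the
  rules of \<open>occurs_before\<close> for append and filter apply to products.\<close>

lemma mult_free_lrb:
  assumes "u \<in> carrier (free_lrb V)" "w \<in> carrier (free_lrb V)"
  shows "u \<otimes>\<^bsub>free_lrb V\<^esub> w = u @ filter (\<lambda>y. y \<notin> set u) w"
  using assms by (simp add: free_lrb_def keep_first_append keep_first_id)

text \<open>In a product, x precedes y iff x precedes y in the first factor, or x is in the first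
  factor and y is new in the second, or both are new and x precedes y in the second. For a fixed
  non-edge this depends only on the letter sets of the factors and on the precedence of that same
  pair in them.\<close>

lemma same_orientation_congruence:
  "monoid_congruence (free_lrb V)
     {(v, w) \<in> carrier (free_lrb V) \<times> carrier (free_lrb V). same_orientation E v w}"
    (is "monoid_congruence _ ?r")
  unfolding monoid_congruence_def
proof (intro conjI ballI, unfold split_paired_all split_conv)
  show "equiv (carrier (free_lrb V)) ?r"
    by (rule equivI) (auto simp: same_orientation_def refl_on_def intro!: symI transI)
next
  fix a a' assume aa: "(a, a') \<in> ?r"
  show "\<forall>(b, b')\<in>?r. (a \<otimes>\<^bsub>free_lrb V\<^esub> b, a' \<otimes>\<^bsub>free_lrb V\<^esub> b') \<in> ?r"
  proof (intro ballI, unfold split_paired_all split_conv)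
    fix b b' assume bb: "(b, b') \<in> ?r"
    have "same_orientation E (a @ filter (\<lambda>y. y \<notin> set a) b) (a' @ filter (\<lambda>y. y \<notin> set a') b')"
      using aa bb by (auto simp: same_orientation_def)
    then show "(a \<otimes>\<^bsub>free_lrb V\<^esub> b, a' \<otimes>\<^bsub>free_lrb V\<^esub> b') \<in> ?r"
      using aa bb by (auto simp: mult_free_lrb carrier_free_lrb)
  qed
qed

text \<open>The generated congruence lies inside every congruence containing the relations, so
  checking generators suffices: \<open>[x, y]\<close> and \<open>[y, x]\<close> differ only in the
  order of an edge, which \<open>same_orientation\<close> ignores.\<close>

lemma pc_congruence_same_orientation:
  assumes "simple_graph V E" and "(v, w) \<in> pc_congruence V E"
  shows "same_orientation E v w"
proof -
  let ?r = "{(v, w) \<in> carrier (free_lrb V) \<times> carrier (free_lrb V). same_orientation E v w}"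
  have "commutation_relations V E \<subseteq> ?r"
  proof
    fix p assume "p \<in> commutation_relations V E"
    then obtain x y where p: "p = ([x] \<otimes>\<^bsub>free_lrb V\<^esub> [y], [y] \<otimes>\<^bsub>free_lrb V\<^esub> [x])" and e: "{x, y} \<in> E"
      by (auto simp: commutation_relations_def)
    then have xy: "x \<in> V" "y \<in> V" "x \<noteq> y" using assms(1) by (auto simp: simple_graph_def)
    \<comment> \<open>An edge has two distinct ends, so neither product deletes a letter.\<close>
    then have "p = ([x, y], [y, x])" by (auto simp: p free_lrb_def)
    then show "p \<in> ?r"
      using xy e by (auto simp: carrier_free_lrb same_orientation_def insert_commute)
  qed
  then have "pc_congruence V E \<subseteq> ?r"
    unfolding pc_congruence_def generated_congruence_def
    using same_orientation_congruence[of V E] by blast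
  then show ?thesis using assms(2) by blast
qed

lemma pc_congruence_equiv:
  "simple_graph V E \<Longrightarrow> equiv (carrier (free_lrb V)) (pc_congruence V E)"
  using monoid_congruence_pc_congruence by (auto simp: monoid_congruence_def)

lemma pc_congruence_refl:
  "simple_graph V E \<Longrightarrow> w \<in> carrier (free_lrb V) \<Longrightarrow> (w, w) \<in> pc_congruence V E"
  using pc_congruence_equiv by (auto simp: equiv_def refl_on_def)

lemma pc_congruence_mult:
  assumes "simple_graph V E" "(a, a') \<in> pc_congruence V E" "(b, b') \<in> pc_congruence V E"
  shows "(a \<otimes>\<^bsub>free_lrb V\<^esub> b, a' \<otimes>\<^bsub>free_lrb V\<^esub> b') \<in> pc_congruence V E"
  using monoid_congruence_pc_congruence[OF assms(1)] assms(2,3)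
  by (auto simp: monoid_congruence_def)

text \<open>Concatenation is the product when the factors share no letter. Distinctness of the left
  word is enough, since congruent words have the same letters.\<close>

lemma pc_congruence_append:
  assumes "simple_graph V E" "(a, a') \<in> pc_congruence V E" "(b, b') \<in> pc_congruence V E"
    and "distinct (a @ b)"
  shows "(a @ b, a' @ b') \<in> pc_congruence V E"
proof -
  have car: "a \<in> carrier (free_lrb V)" "a' \<in> carrier (free_lrb V)"
      "b \<in> carrier (free_lrb V)" "b' \<in> carrier (free_lrb V)"
    using equiv_type[OF pc_congruence_equiv[OF assms(1)]] assms(2,3) by auto
  have s: "set a = set a'" "set b = set b'"
    using pc_congruence_same_orientation[OF assms(1)] assms(2,3)
    by (auto simp: same_orientation_def)
  have "filter (\<lambda>y. y \<notin> set a) b = b" "filter (\<lambda>y. y \<notin> set a') b' = b'"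
    using assms(4) s by (auto simp: filter_id_conv)
  then show ?thesis
    using pc_congruence_mult[OF assms(1-3)] car by (simp add: mult_free_lrb)
qed

lemma pc_congruence_swap:
  assumes "simple_graph V E" "{x, y} \<in> E"
  shows "([x, y], [y, x]) \<in> pc_congruence V E"
proof -
  have "x \<noteq> y" using assms by (auto simp: simple_graph_def)
  then have "[x] \<otimes>\<^bsub>free_lrb V\<^esub> [y] = [x, y]" "[y] \<otimes>\<^bsub>free_lrb V\<^esub> [x] = [y, x]"
    by (simp_all add: free_lrb_def)
  moreover have "([x] \<otimes>\<^bsub>free_lrb V\<^esub> [y], [y] \<otimes>\<^bsub>free_lrb V\<^esub> [x]) \<in> commutation_relations V E"
    using assms(2) unfolding commutation_relations_def by blast
  ultimately show ?thesis
    by (auto simp: pc_congruence_def generated_congruence_def)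
qed

text \<open>Induction on the prefix: behind its first letter \<open>z\<close>, the letter
  \<open>x\<close> is moved past the rest of the prefix, and then \<open>z\<close> and
  \<open>x\<close> are swapped along their edge.\<close>

lemma pc_congruence_move_to_front:
  assumes "simple_graph V E" "p @ x # s \<in> carrier (free_lrb V)" "\<forall>z\<in>set p. {z, x} \<in> E"
  shows "(p @ x # s, x # p @ s) \<in> pc_congruence V E"
  using assms(2,3)
proof (induction p)
  case Nil
  then show ?case using pc_congruence_refl[OF assms(1)] by simp
next
  case (Cons z p)
  have IH: "(p @ x # s, x # p @ s) \<in> pc_congruence V E"
    using Cons by (auto simp: carrier_free_lrb)
  have "([z], [z]) \<in> pc_congruence V E"
    using Cons.prems by (intro pc_congruence_refl[OF assms(1)]) (auto simp: carrier_free_lrb)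
  from pc_congruence_append[OF assms(1) this IH]
  have 1: "(z # p @ x # s, z # x # p @ s) \<in> pc_congruence V E"
    using Cons.prems by (auto simp: carrier_free_lrb)
  have "([z, x], [x, z]) \<in> pc_congruence V E"
    using Cons.prems by (intro pc_congruence_swap[OF assms(1)]) auto
  moreover have "(p @ s, p @ s) \<in> pc_congruence V E"
    using Cons.prems by (intro pc_congruence_refl[OF assms(1)]) (auto simp: carrier_free_lrb)
  ultimately have "([z, x] @ p @ s, [x, z] @ p @ s) \<in> pc_congruence V E"
    by (rule pc_congruence_append[OF assms(1)])
      (use Cons.prems in \<open>auto simp: carrier_free_lrb\<close>)
  then have "(z # x # p @ s, x # z # p @ s) \<in> pc_congruence V E" by simp
  with 1 show ?case
    using pc_congruence_equiv[OF assms(1)] by (auto simp: equiv_def dest: transD)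
qed

lemma same_orientation_pc_congruence:
  assumes "simple_graph V E" "v \<in> carrier (free_lrb V)" "w \<in> carrier (free_lrb V)"
    and "same_orientation E v w"
  shows "(v, w) \<in> pc_congruence V E"
  using assms(2-)
\<comment> \<open>\<open>w\<close> must vary, because the induction hypothesis is used for
  \<open>w\<close> with \<open>x\<close> removed.\<close>
proof (induction v arbitrary: w)
  case Nil
  then show ?case using pc_congruence_refl[OF assms(1)] by (auto simp: same_orientation_def)
next
  case (Cons x v)
  have "x \<in> set w" using Cons.prems(3) by (auto simp: same_orientation_def)
  then obtain p s where w: "w = p @ x # s" by (auto dest: split_list)
  have d: "distinct (x # v)" "distinct (p @ x # s)" "set (x # v) = set (p @ x # s)"
      "set (x # v) \<subseteq> V"
    using Cons.prems unfolding w by (auto simp: carrier_free_lrb same_orientation_def)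
  have before: "occurs_before (x # v) a b = occurs_before (p @ x # s) a b" if "{a, b} \<notin> E" for a b
    using Cons.prems(3) that unfolding w same_orientation_def by blast
  have adjacent: "{z, x} \<in> E" if z: "z \<in> set p" for z
  proof (rule ccontr)
    assume "{z, x} \<notin> E"
    \<comment> \<open>Impossible: \<open>x\<close> is the first letter of \<open>x # v\<close> and
      does not recur, so nothing precedes it.\<close>
    then have "occurs_before (x # v) z x" using before z by simp
    then show False using d z by (auto dest: occurs_before_in_set)
  qed
  have s: "set v = set (p @ s)" using d by auto
  have "occurs_before v a b = occurs_before (p @ s) a b" if "{a, b} \<notin> E" for a b
  proof (cases "a = x \<or> b = x")
    case True
    \<comment> \<open>\<open>x\<close> is a letter of neither \<open>v\<close> nor
      \<open>p @ s\<close>, so both sides are false.\<close>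
    then show ?thesis using d s by (auto dest: occurs_before_in_set)
  next
    case False
    \<comment> \<open>Removing \<open>x\<close> leaves the order of the other letters unchanged in
      both words.\<close>
    then show ?thesis using before[OF that] by auto
  qed
  with s have "same_orientation E v (p @ s)" by (simp add: same_orientation_def)
  then have tail: "(v, p @ s) \<in> pc_congruence V E"
    using d by (intro Cons.IH) (auto simp: carrier_free_lrb)
  have "([x], [x]) \<in> pc_congruence V E"
    using d by (intro pc_congruence_refl[OF assms(1)]) (auto simp: carrier_free_lrb)
  then have "([x] @ v, [x] @ p @ s) \<in> pc_congruence V E"
    by (rule pc_congruence_append[OF assms(1) _ tail]) (use d in auto)
  moreover have "(p @ x # s, x # p @ s) \<in> pc_congruence V E"
    using Cons.prems(2) adjacent unfolding w
    by (intro pc_congruence_move_to_front[OF assms(1)]) auto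
  ultimately show ?case
    using pc_congruence_equiv[OF assms(1)] unfolding w
    by (auto simp: equiv_def dest: transD symD)
qed

theorem theorem1:
  fixes V :: "'a set" and E :: "'a set set" and v w :: "'a list"
  assumes "simple_graph V E"
    and "v \<in> carrier (free_lrb V)" and "w \<in> carrier (free_lrb V)"
  shows "pc_image V E v = pc_image V E w \<longleftrightarrow>
    set v = set w \<and> orientation V E v = orientation V E w"
proof -
  \<comment> \<open>Images are equivalence classes, so they agree exactly when their representatives
    are congruent.\<close>
  have "pc_image V E v = pc_image V E w \<longleftrightarrow> (v, w) \<in> pc_congruence V E"
    using eq_equiv_class_iff[OF pc_congruence_equiv[OF assms(1)] assms(2,3)]
    by (simp add: pc_image_def)
  also have "\<dots> \<longleftrightarrow> same_orientation E v w"
    using pc_congruence_same_orientation same_orientation_pc_congruence assms by blast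
  finally show ?thesis using same_orientation_iff[OF assms(2,3)] by simp
qed

end
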